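(* The function $a \mapsto \ln a$ is continuous and nondecreasing on $\{a \in \mathbb{R} : a > 0\}$, where $\ln a$ is defined as the derivative at $x = 0$ of $x \mapsto a^x$.
   Context: For real $a > 0$, $a^x$ ($x \in \mathbb{R}$) is the continuous extension to $\mathbb{R}$ of the function $q \mapsto a^q$ defined on $\mathbb{Q}$ (rational powers). Equivalently, $a^x = \sup\{a^q : q \in \mathbb{Q},\ q < x\}$ if $a \ge 1$, and $a^x = \inf\{a^q : q \in \mathbb{Q},\ q < x\}$ if $0 < a < 1$. For every real $a>0$ the function $x \mapsto a^x$ is differentiable at $0$, and $\ln : (0,\infty) \to \mathbb{R}$ is defined by $\ln a = \left.\frac{d}{dx} a^x\right|_{x=0}$, i.e. $\ln a = \lim_{h \to 0} \frac{a^h - 1}{h}$. *)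

theory Defs
  imports "HOL-Analysis.Analysis"
begin

text \<open>
  The library's \<^const>\<open>powr\<close> is defined through \<^const>\<open>exp\<close> and \<^const>\<open>ln\<close>, so it
  would be circular here. Powers are built from roots instead: first for rational exponents, then
  by continuous extension. All definitions below are meant for a positive base.
\<close>

definition rat_pow :: "real \<Rightarrow> rat \<Rightarrow> real" where
  "rat_pow a q = (case quotient_of q of (m, n) \<Rightarrow> root (nat n) a powi m)"

definition real_pow :: "real \<Rightarrow> real \<Rightarrow> real" where
  "real_pow a = (THE f. continuous_on UNIV f \<and> (\<forall>q. f (of_rat q) = rat_pow a q))"

definition deriv_ln :: "real \<Rightarrow> real" where
  "deriv_ln a = deriv (\<lambda>x. real_pow a x) 0"

text \<open>
  For a positive base the definite description in \<^const>\<open>real_pow\<close> and the choice of a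
  derivative hidden in \<^const>\<open>deriv\<close> are justified. The library's \<^const>\<open>powr\<close> occurs
  in the proofs only, as a witness for existence.
\<close>

lemma rat_pow_eq_powr:
  assumes "a > 0"
  shows "rat_pow a q = a powr of_rat q"
proof -
  obtain m n where q: "quotient_of q = (m, n)" by (cases "quotient_of q")
  then have n: "n > 0" by (rule quotient_of_denom_pos)
  have "q = of_int m / of_int n" using q by (rule quotient_of_div)
  then have "real_of_rat q = of_int m / of_int n" by (simp add: of_rat_divide)
  moreover have "root (nat n) a = a powr (1 / of_int n)"
    using n assms by (simp add: root_powr_inverse)
  ultimately show ?thesis
    using assms n by (simp add: rat_pow_def q powr_real_of_int' [symmetric] powr_powr)
qed

lemma ex1_real_pow:
  assumes "a > 0"
  shows "\<exists>!f :: real \<Rightarrow> real. continuous_on UNIV f \<and> (\<forall>q. f (of_rat q) = rat_pow a q)"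
proof (rule ex1I)
  show "continuous_on UNIV (\<lambda>x. a powr x) \<and> (\<forall>q. a powr (of_rat q) = rat_pow a q)"
    using assms by (auto intro!: continuous_intros simp: rat_pow_eq_powr)
next
  fix f :: "real \<Rightarrow> real"
  assume f: "continuous_on UNIV f \<and> (\<forall>q. f (of_rat q) = rat_pow a q)"
  have "closed {x. f x = a powr x}"
    using f assms by (intro closed_Collect_eq) (auto intro!: continuous_intros)
  moreover have "\<rat> \<subseteq> {x. f x = a powr x}"
    using f assms by (auto simp: Rats_def rat_pow_eq_powr)
  ultimately have "closure \<rat> \<subseteq> {x. f x = a powr x}" by (simp add: closure_minimal)
  then show "f = (\<lambda>x. a powr x)" by (auto simp: Rats_closure_real)
qed

lemma
  assumes "a > 0"
  shows continuous_on_real_pow: "continuous_on UNIV (real_pow a)"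
    and real_pow_of_rat: "real_pow a (of_rat q) = rat_pow a q"
  using theI' [OF ex1_real_pow [OF assms]] unfolding real_pow_def by auto

lemma real_pow_differentiable_at_0:
  assumes "a > 0"
  shows "real_pow a field_differentiable at 0"
proof -
  have "real_pow a = (\<lambda>x. a powr x)"
    unfolding real_pow_def using ex1_real_pow [OF assms]
    by (rule the1_equality) (use assms in \<open>auto simp: rat_pow_eq_powr intro!: continuous_intros\<close>)
  moreover have "((\<lambda>x. a powr x) has_field_derivative ln a) (at 0)"
    using assms by (auto intro!: derivative_eq_intros)
  ultimately show ?thesis by (auto simp: field_differentiable_def)
qed

end

theory Submission
  imports Defs
begin

text \<open>For a positive base, \<open>powr\<close> is a continuous extension of the rational
  powers; such an extension is unique, so it is \<open>real_pow a\<close>. Hence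
  \<open>deriv_ln\<close> is the library's \<open>ln\<close> on the positive reals
  (\<open>deriv_ln_eq_ln\<close>), and continuity and monotonicity carry over.\<close>

lemma real_pow_eq_powr:
  assumes "a > 0"
  shows "real_pow a = (\<lambda>x. a powr x)"
  unfolding real_pow_def using ex1_real_pow [OF assms]
  by (rule the1_equality) (use assms in \<open>auto simp: rat_pow_eq_powr intro!: continuous_intros\<close>)

lemma deriv_ln_eq_ln:
  assumes "a > 0"
  shows "deriv_ln a = ln a"
proof -
  \<comment> \<open>The derivative at x is \<open>ln a * a powr x\<close>, and
    \<open>a powr 0 = 1\<close> as \<open>a\<close> is nonzero.\<close>
  have "((\<lambda>x. a powr x) has_field_derivative ln a) (at 0)"
    using assms by (auto intro!: derivative_eq_intros)
  then show ?thesis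
    by (simp add: deriv_ln_def real_pow_eq_powr [OF assms] DERIV_imp_deriv)
qed

theorem theorem3p10:
  shows "continuous_on {a::real. a > 0} deriv_ln \<and> mono_on {a::real. a > 0} deriv_ln"
proof
  have "continuous_on {a::real. a > 0} ln"
    by (auto intro!: continuous_intros)
  then show "continuous_on {a::real. a > 0} deriv_ln"
    by (rule continuous_on_eq) (simp add: deriv_ln_eq_ln)
  show "mono_on {a::real. a > 0} deriv_ln"
    by (rule mono_onI) (simp add: deriv_ln_eq_ln)
qed

end
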